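(* Let $N\ge 1$, let $\omega\in\mathbb{C}$ with $|\omega|=1$, and let $a_0,\dots,a_{N-1}\in\mathbb{C}$ with $|a_n|<1$ for $n=0,\dots,N-1$, and $a_N=\omega$, $a_{-1}=-1$. Let $\Phi_0,\dots,\Phi_{N+1}$ be the associated monic polynomials orthogonal on the unit circle (OPUC) and $h_N=\prod_{k=0}^{N-1}(1-|a_k|^2)$. Assume the OPUC are persymmetric, i.e. $a_n=-\omega\,\overline{a_{N-1-n}}$ for $n=0,1,\dots,N$, and write the roots of $\Phi_{N+1}$ as $z_s=\exp(i\theta_s)$, $s=0,\dots,N$, with $$0\le\theta_0<\theta_1<\dots<\theta_N<2\pi.$$ Fix a square root $\omega^{1/2}$ of $\omega$ and let $\omega^{-1/2}$ be its inverse. Then there is a sign $\varepsilon\in\{1,-1\}$, independent of $s$, such that $$\Phi_N(z_s)=(-1)^s\,\varepsilon\,\omega^{-1/2}\exp\!\left(\frac{i(N-1)\theta_s}{2}\right)\sqrt{h_N},\qquad s=0,1,\dots,N.$$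
   Context: The monic polynomials are defined by $\Phi_0=1$ and the Szegő recurrence $\Phi_{n+1}(z)=z\Phi_n(z)-\overline{a_n}\,\Phi_n^*(z)$ for $n=0,\dots,N$, where $\Phi_n^*(z)=z^n\overline{\Phi}_n(1/z)$ and $\overline{\Phi}_n$ denotes the polynomial obtained from $\Phi_n$ by conjugating its coefficients. Since $|a_N|=1$, the polynomial $\Phi_{N+1}$ has $N+1$ distinct roots on the unit circle. *)

theory Defs
  imports Complex_Main "HOL-Computational_Algebra.Polynomial"
begin

text \<open>
  The coefficients are indexed by \<^typ>\<open>int\<close> so that \<open>a (-1)\<close> is available.
  \<open>star p\<close> is the polynomial \<open>z^n * q (1/z)\<close>, where \<open>n = degree p\<close> and \<open>q\<close> has the
  conjugated coefficients of \<open>p\<close>; on \<open>opuc a n\<close>, which is monic of degree \<open>n\<close>, this is the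
  usual reversal (see \<open>poly_star_opuc\<close>).
\<close>

definition star :: "complex poly \<Rightarrow> complex poly" where
  "star p = reflect_poly (map_poly cnj p)"

primrec opuc :: "(int \<Rightarrow> complex) \<Rightarrow> nat \<Rightarrow> complex poly" where
  "opuc a 0 = 1"
| "opuc a (Suc n) = [:0, 1:] * opuc a n - smult (cnj (a (int n))) (star (opuc a n))"

definition opuc_norm :: "(int \<Rightarrow> complex) \<Rightarrow> nat \<Rightarrow> real" where
  "opuc_norm a n = (\<Prod>k<n. 1 - (cmod (a (int k)))\<^sup>2)"

definition persymmetric :: "(int \<Rightarrow> complex) \<Rightarrow> complex \<Rightarrow> nat \<Rightarrow> bool" where
  "persymmetric a \<omega> N \<longleftrightarrow> (\<forall>n\<in>{0..int N}. a n = - \<omega> * cnj (a (int N - 1 - n)))"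

lemma degree_star_le: "degree (star p) \<le> degree p"
  unfolding star_def
  using degree_reflect_poly_le[of "map_poly cnj p"] by (simp add: degree_map_poly)

lemma degree_opuc: "degree (opuc a n) = n"
  and lead_coeff_opuc: "lead_coeff (opuc a n) = 1"
proof -
  have "degree (opuc a n) = n \<and> lead_coeff (opuc a n) = 1"
  proof (induction n)
    case 0
    show ?case by simp
  next
    case (Suc n)
    let ?p = "opuc a n" and ?r = "smult (cnj (a (int n))) (star (opuc a n))"
    have p: "?p \<noteq> 0" using Suc by auto
    have l: "degree ([:0, 1:] * ?p) = Suc n" "coeff ([:0, 1:] * ?p) (Suc n) = 1"
      using Suc p by (auto simp: degree_pCons_eq)
    have r: "degree ?r < Suc n"
      using degree_star_le[of ?p] degree_smult_le[of "cnj (a (int n))" "star ?p"] Suc by linarith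
    have c: "coeff (opuc a (Suc n)) (Suc n) = 1"
      using l(2) coeff_eq_0[OF r] by simp
    have "degree (opuc a (Suc n)) \<le> Suc n"
      using degree_diff_le[of "[:0, 1:] * ?p" "Suc n" ?r] l r by simp
    moreover have "Suc n \<le> degree (opuc a (Suc n))"
      using c by (metis le_degree zero_neq_one)
    ultimately show ?case using c by (metis le_antisym)
  qed
  then show "degree (opuc a n) = n" "lead_coeff (opuc a n) = 1" by auto
qed

lemma poly_star_opuc:
  assumes "z \<noteq> 0"
  shows "poly (star (opuc a n)) z = z ^ n * poly (map_poly cnj (opuc a n)) (1 / z)"
proof -
  have "degree (map_poly cnj (opuc a n)) = n"
    using degree_opuc[of a n] by (simp add: degree_map_poly)
  then show ?thesis
    using assms by (simp add: star_def poly_reflect_poly_nz inverse_eq_divide)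
qed

end

theory Submission imports Defs begin

text \<open>
  On the unit circle put \<open>f\<^sub>n(t) = exp (- i n t / 2) \<Phi>\<^sub>n (exp (i t))\<close>. The Szego recurrence
  becomes \<open>f\<^sub>n\<^sub>+\<^sub>1 = g - cnj a\<^sub>n * cnj g\<close> with \<open>g = exp (i t / 2) f\<^sub>n\<close>, and \<open>exp (i t)\<close> is a root of
  \<open>\<Phi>\<^sub>N\<^sub>+\<^sub>1\<close> iff \<open>F(t) = \<omega>r exp (i t / 2) f\<^sub>N(t)\<close> is real. Persymmetry yields a bilinear quantity
  in \<open>f\<close> and its second-kind analogue (coefficients \<open>- a\<^sub>n\<close>) that is conserved when the
  indices run in opposite directions; combined with the Wronskian of the two it gives
  \<open>F\<^sup>2 = h\<^sub>N\<close> at the roots. Finally \<open>Im (F' cnj F) > 0\<close>, so the phase of \<open>F\<close> strictly increases: if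
  \<open>F\<close> had the same sign at two consecutive roots, then \<open>Im F\<close> would vanish strictly in between.
\<close>

section \<open>The Szego recurrence on the unit circle\<close>

definition circle_opuc :: "(int \<Rightarrow> complex) \<Rightarrow> nat \<Rightarrow> real \<Rightarrow> complex" where
  "circle_opuc a n t = cis (- (real n * t / 2)) * poly (opuc a n) (cis t)"

lemma circle_opuc_0 [simp]: "circle_opuc a 0 t = 1"
  by (simp add: circle_opuc_def)

lemma poly_opuc_cis: "poly (opuc a n) (cis t) = cis (real n * t / 2) * circle_opuc a n t"
  by (simp add: circle_opuc_def mult.assoc [symmetric] cis_mult)

text \<open>On the unit circle \<open>1 / z\<close> equals \<open>cnj z\<close>, so reversal is
  complex conjugation up to the factor \<open>z ^ n\<close>.\<close>

lemma poly_star_opuc_cis: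
  "poly (star (opuc a n)) (cis t) = cis (real n * t) * cnj (poly (opuc a n) (cis t))"
  by (simp add: poly_star_opuc DeMoivre cis_cnj flip: cis_inverse inverse_eq_divide)

lemma circle_opuc_Suc:
  "circle_opuc a (Suc n) t =
    cis (t / 2) * circle_opuc a n t - cnj (a (int n)) * cnj (cis (t / 2) * circle_opuc a n t)"
proof -
  have 1: "cis (- (real (Suc n) * t / 2)) * cis t * cis (real n * t / 2) = cis (t / 2)"
    unfolding cis_mult by (rule arg_cong [of _ _ cis]) (simp add: field_simps)
  have 2: "cis (- (real (Suc n) * t / 2)) * cis (real n * t) * cnj (cis (real n * t / 2)) = cnj (cis (t / 2))"
    unfolding cis_mult cis_cnj by (rule arg_cong [of _ _ cis]) (simp add: field_simps)
  have "circle_opuc a (Suc n) t =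
      (cis (- (real (Suc n) * t / 2)) * cis t * cis (real n * t / 2)) * circle_opuc a n t
      - cnj (a (int n)) * ((cis (- (real (Suc n) * t / 2)) * cis (real n * t) * cnj (cis (real n * t / 2)))
          * cnj (circle_opuc a n t))"
    unfolding circle_opuc_def [of a "Suc n"]
    by (simp add: poly_star_opuc_cis poly_opuc_cis algebra_simps del: cis_cnj)
  then show ?thesis
    unfolding 1 2 by simp
qed

section \<open>Quadratic identities for one step, and the Wronskian\<close>

lemma opuc_norm_Suc: "opuc_norm a (Suc n) = (1 - (cmod (a (int n)))\<^sup>2) * opuc_norm a n"
  by (simp add: opuc_norm_def)

lemma opuc_norm_pos:
  assumes "\<And>k. k < n \<Longrightarrow> cmod (a (int k)) < 1"
  shows "0 < opuc_norm a n"
  unfolding opuc_norm_def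
  by (rule prod_pos) (use assms in \<open>auto simp: abs_square_less_1\<close>)

text \<open>With opposite signs of the coefficient the cross terms form a number minus its
  conjugate, which has no real part; the term in \<open>cnj p * q\<close> has the same real part as
  \<open>p * cnj q\<close>.\<close>

lemma Re_mult_cnj_step:
  fixes p q \<alpha> :: complex
  shows "Re ((p - cnj \<alpha> * cnj p) * cnj (q + cnj \<alpha> * cnj q)) = (1 - (cmod \<alpha>)\<^sup>2) * Re (p * cnj q)"
  unfolding cmod_power2 by (simp add: power2_eq_square algebra_simps)

text \<open>Here the cross terms add up to a real number, and conjugating \<open>q * cnj p\<close>
  flips its imaginary part. In the application \<open>q\<close> is the derivative of
  \<open>p\<close>.\<close>

lemma Im_mult_cnj_step:
  fixes p q \<alpha> :: complex
  shows "Im ((q - cnj \<alpha> * cnj q) * cnj (p - cnj \<alpha> * cnj p)) = (1 - (cmod \<alpha>)\<^sup>2) * Im (q * cnj p)"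
  unfolding cmod_power2 by (simp add: power2_eq_square algebra_simps)

lemma cis_mult_cnj [simp]: "cis t * cnj (cis t) = 1" "cnj (cis t) * cis t = 1"
  by (simp_all add: cis_cnj cis_mult)

text \<open>Negated coefficients give the polynomials of the second kind. The common rotation
  \<open>cis (t / 2)\<close> cancels, so each step contributes only its factor of
  \<open>opuc_norm\<close>.\<close>

lemma Re_circle_opuc_wronskian:
  "Re (circle_opuc a n t * cnj (circle_opuc (\<lambda>k. - a k) n t)) = opuc_norm a n"
proof (induction n)
  case 0
  show ?case by (simp add: opuc_norm_def)
next
  case (Suc n)
  let ?e = "cis (t / 2)"
  let ?f = "circle_opuc a n t" and ?g = "circle_opuc (\<lambda>k. - a k) n t"
  have "?e * ?f * cnj (?e * ?g) = (?e * cnj ?e) * (?f * cnj ?g)"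
    by (simp only: complex_cnj_mult ac_simps)
  then have "Re (?e * ?f * cnj (?e * ?g)) = opuc_norm a n"
    by (simp only: cis_mult_cnj mult_1 Suc)
  then show ?case
    using Re_mult_cnj_step [of "?e * ?f" "a (int n)" "?e * ?g"]
    by (simp add: circle_opuc_Suc opuc_norm_Suc del: cis_cnj)
qed

section \<open>Monotonicity of the phase\<close>

lemma has_vector_derivative_cis_half_mult:
  assumes "(f has_vector_derivative D) (at t)"
  shows "((\<lambda>t. cis (t / 2) * f t) has_vector_derivative
    cis (t / 2) * D + \<i> / 2 * cis (t / 2) * f t) (at t)"
proof -
  have "((\<lambda>t. cis (t / 2)) has_vector_derivative \<i> / 2 * cis (t / 2)) (at t)"
    unfolding has_vector_derivative_def
    by (rule derivative_eq_intros refl)+ (auto simp: scaleR_conv_of_real)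
  from has_vector_derivative_mult [OF this assms] show ?thesis
    by simp
qed

text \<open>For \<open>s = t / 2\<close> the rotation adds \<open>1 / 2\<close> to the angular
  speed, which accounts for the term in \<open>(cmod f)\<^sup>2 / 2\<close>.\<close>

lemma Im_cis_half_mult_derivative:
  fixes f D :: complex
  shows "Im ((cis s * D + \<i> / 2 * cis s * f) * cnj (cis s * f)) = Im (D * cnj f) + (cmod f)\<^sup>2 / 2"
proof -
  have "(cis s * D + \<i> / 2 * cis s * f) * cnj (cis s * f)
      = (cis s * cnj (cis s)) * (D * cnj f + \<i> / 2 * (f * cnj f))"
    by (simp add: algebra_simps del: cis_cnj cis_mult_cnj)
  then show ?thesis
    by (simp add: complex_mult_cnj cmod_power2)
qed

text \<open>Each rotation adds a nonnegative term and each Szego step rescales by a positive factor.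
  The inequality is weak because the induction starts from a constant; one further rotation makes it
  strict later.\<close>

lemma circle_opuc_phase_increasing:
  assumes "\<And>k. k < n \<Longrightarrow> cmod (a (int k)) < 1"
  obtains D where "(circle_opuc a n has_vector_derivative D) (at t)"
    and "0 \<le> Im (D * cnj (circle_opuc a n t))"
proof -
  have "\<exists>D. (circle_opuc a n has_vector_derivative D) (at t) \<and> 0 \<le> Im (D * cnj (circle_opuc a n t))"
    using assms
  proof (induction n)
    case 0
    have "circle_opuc a 0 = (\<lambda>t. 1)" by auto
    then show ?case by (auto intro!: exI [of _ 0])
  next
    case (Suc n)
    let ?e = "cis (t / 2)" and ?f = "circle_opuc a n t" and ?\<alpha> = "a (int n)"
    obtain D where D: "(circle_opuc a n has_vector_derivative D) (at t)" "0 \<le> Im (D * cnj ?f)"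
      using Suc by (meson less_SucI)
    define E where "E = ?e * D + \<i> / 2 * ?e * ?f"
    have E: "((\<lambda>t. cis (t / 2) * circle_opuc a n t) has_vector_derivative E) (at t)"
      using has_vector_derivative_cis_half_mult [OF D(1)] by (simp add: E_def)
    have "circle_opuc a (Suc n) = (\<lambda>t. cis (t / 2) * circle_opuc a n t
        - cnj ?\<alpha> * cnj (cis (t / 2) * circle_opuc a n t))"
      by (rule ext) (rule circle_opuc_Suc)
    then have deriv: "(circle_opuc a (Suc n) has_vector_derivative E - cnj ?\<alpha> * cnj E) (at t)"
      using has_vector_derivative_diff [OF E has_vector_derivative_mult_right
          [OF has_vector_derivative_cnj [OF E], of "cnj ?\<alpha>"]] by simp
    have "0 \<le> Im (E * cnj (?e * ?f))"
      unfolding E_def Im_cis_half_mult_derivative using D(2) by simp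
    moreover have "(cmod ?\<alpha>)\<^sup>2 \<le> 1"
      using Suc.prems [of n] by (simp add: abs_square_le_1)
    ultimately have "0 \<le> Im ((E - cnj ?\<alpha> * cnj E) * cnj (circle_opuc a (Suc n) t))"
      unfolding circle_opuc_Suc Im_mult_cnj_step by (intro mult_nonneg_nonneg) auto
    with deriv show ?case by blast
  qed
  then show ?thesis using that by blast
qed

section \<open>Consequences of persymmetry\<close>

text \<open>The indices \<open>N - n\<close> and \<open>n\<close> move in opposite directions. At
  \<open>n = N\<close> the first-kind factor is 1, so the law ties both kinds together at index
  \<open>N\<close>.\<close>

lemma persymmetric_bilinear_conserved:
  assumes pers: "persymmetric a \<omega> N" and \<omega>: "cmod \<omega> = 1" and "n \<le> N"
  shows "circle_opuc a (N - n) t * circle_opuc (\<lambda>k. - a k) n t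
      + cnj (\<omega> * cis t) * cnj (circle_opuc a (N - n) t * circle_opuc (\<lambda>k. - a k) n t)
    = circle_opuc a N t + cnj (\<omega> * cis t) * cnj (circle_opuc a N t)"
  using \<open>n \<le> N\<close>
proof (induction n)
  case 0
  show ?case by simp
next
  case (Suc n)
  define m where "m = N - Suc n"
  have m: "N - n = Suc m" "int N - 1 - int m = int n" "int m \<in> {0..int N}"
    using Suc.prems by (auto simp: m_def of_nat_diff)
  define e f g \<alpha> where "e = cis (t / 2)" and "f = circle_opuc a m t"
    and "g = circle_opuc (\<lambda>k. - a k) n t" and "\<alpha> = a (int n)"
  have am: "a (int m) = - \<omega> * cnj \<alpha>"
    using pers m unfolding persymmetric_def \<alpha>_def by metis
  have e: "e * cnj e = 1"
    by (simp add: e_def)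
  have ww: "\<omega> * cnj \<omega> = 1"
    using \<omega> by (simp flip: complex_norm_square)
  have z: "cis t = e * e"
    by (simp add: e_def cis_mult)
  have f: "circle_opuc a (Suc m) t = e * f + cnj \<omega> * \<alpha> * cnj (e * f)"
    by (simp add: circle_opuc_Suc am e_def f_def del: cis_cnj)
  have g: "circle_opuc (\<lambda>k. - a k) (Suc n) t = e * g + cnj \<alpha> * cnj (e * g)"
    by (simp add: circle_opuc_Suc e_def g_def \<alpha>_def del: cis_cnj)
  \<comment> \<open>Both sides expand to the same four monomials; the value of
    \<open>a (int m)\<close> is what makes the two mixed ones in \<open>f * cnj g\<close> and
    \<open>cnj f * g\<close> agree.\<close>
  have "f * (e * g + cnj \<alpha> * cnj (e * g)) + cnj (\<omega> * (e * e)) * cnj (f * (e * g + cnj \<alpha> * cnj (e * g)))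
    = (e * f + cnj \<omega> * \<alpha> * cnj (e * f)) * g + cnj (\<omega> * (e * e)) * cnj ((e * f + cnj \<omega> * \<alpha> * cnj (e * f)) * g)"
    unfolding complex_cnj_mult complex_cnj_add complex_cnj_cnj using e ww by algebra
  then show ?case
    using Suc unfolding m(1) f g z m_def [symmetric] f_def [symmetric] g_def [symmetric] by simp
qed

text \<open>At a root the right side of the conservation law collapses to \<open>2 * f\<close>.
  Multiplying by \<open>cnj f\<close> turns the left side into twice the Wronskian, and
  \<open>f * cnj f = c * f\<^sup>2\<close>.\<close>

lemma persymmetric_circle_opuc_square:
  assumes "persymmetric a \<omega> N" and "cmod \<omega> = 1"
    and root: "\<omega> * cis t * circle_opuc a N t = cnj (circle_opuc a N t)"
  shows "\<omega> * cis t * (circle_opuc a N t)\<^sup>2 = of_real (opuc_norm a N)"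
proof -
  define f g c where "f = circle_opuc a N t" and "g = circle_opuc (\<lambda>k. - a k) N t"
    and "c = \<omega> * cis t"
  have c: "c * cnj c = 1"
    using assms(2) by (simp add: c_def norm_mult flip: complex_norm_square del: complex_cnj_mult)
  have r: "c * f = cnj f"
    using root by (simp add: c_def f_def)
  have "g + cnj c * cnj g = f + cnj c * cnj f"
    using persymmetric_bilinear_conserved [OF assms(1,2) order_refl, of t]
    by (simp add: f_def g_def c_def)
  then have "2 * (c * f\<^sup>2) = f * cnj g + cnj (f * cnj g)"
    unfolding complex_cnj_mult complex_cnj_cnj using r c by algebra
  also have "\<dots> = 2 * of_real (opuc_norm a N)"
    unfolding complex_add_cnj f_def g_def Re_circle_opuc_wronskian by simp
  finally show ?thesis
    by (simp add: f_def c_def)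
qed

section \<open>Zeros of real functions and injectivity of \<open>cis\<close>\<close>

text \<open>After an upward crossing the function is positive, before the next upward one it is
  negative, so the intermediate value theorem applies; downward crossings reduce to
  \<open>- f\<close>.\<close>

lemma zero_between_same_direction_crossings:
  fixes f :: "real \<Rightarrow> real"
  assumes "u < v" and "f u = 0" and "f v = 0" and cont: "continuous_on {u..v} f"
    and du: "(f has_real_derivative p) (at u)" and dv: "(f has_real_derivative q) (at v)"
    and "0 < p * q"
  shows "\<exists>x. u < x \<and> x < v \<and> f x = 0"
proof -
  have pos: "\<exists>x. u < x \<and> x < v \<and> g x = 0"
    if g: "g u = 0" "g v = 0" "continuous_on {u..v} g"
      and p: "(g has_real_derivative p) (at u)" "0 < p"
      and q: "(g has_real_derivative q) (at v)" "0 < q" for g :: "real \<Rightarrow> real" and p q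
  proof -
    obtain d1 where d1: "0 < d1" "\<And>h. 0 < h \<Longrightarrow> h < d1 \<Longrightarrow> 0 < g (u + h)"
      using DERIV_pos_inc_right [OF p] g(1) by auto
    obtain d2 where d2: "0 < d2" "\<And>h. 0 < h \<Longrightarrow> h < d2 \<Longrightarrow> g (v - h) < 0"
      using DERIV_pos_inc_left [OF q] g(2) by auto
    \<comment> \<open>A third keeps \<open>h\<close> below both radii and \<open>u + h\<close> to
      the left of \<open>v - h\<close>.\<close>
    define h where "h = min (min d1 d2) (v - u) / 3"
    have "h \<le> (v - u) / 3"
      unfolding h_def by (intro divide_right_mono) auto
    then have h: "0 < h" "h < d1" "h < d2" "u + h \<le> v - h"
      using d1(1) d2(1) \<open>u < v\<close> by (auto simp: h_def min_def)
    have "continuous_on {u + h..v - h} g"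
      using h by (intro continuous_on_subset [OF g(3)]) auto
    then obtain x where "u + h \<le> x" "x \<le> v - h" "g x = 0"
      using IVT2' [of g "v - h" 0 "u + h"] d1(2) [of h] d2(2) [of h] h by force
    then show ?thesis using h by (intro exI [of _ x]) auto
  qed
  show ?thesis
  proof (cases "0 < p")
    case True
    then show ?thesis
      using pos [of f p q] assms by (simp add: zero_less_mult_iff)
  next
    case False
    then have "0 < - p" "0 < - q"
      using \<open>0 < p * q\<close> by (auto simp: zero_less_mult_iff)
    then show ?thesis
      using pos [of "\<lambda>x. - f x" "- p" "- q"] assms
      by (auto intro: continuous_on_minus DERIV_minus)
  qed
qed

lemma cis_eq_imp_eq:
  assumes "cis x = cis y" and "0 \<le> x" "x < 2 * pi" "0 \<le> y" "y < 2 * pi"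
  shows "x = y"
proof -
  have "cis (x - y) = 1"
    using assms(1) by (simp flip: cis_divide)
  then have "cos (x - y) = 1"
    by (simp add: complex_eq_iff)
  then obtain k :: int where k: "x - y = of_int k * 2 * pi"
    using cos_one_2pi_int by auto
  have "\<bar>real_of_int k\<bar> * (2 * pi) < 1 * (2 * pi)"
  proof -
    have "\<bar>real_of_int k\<bar> * (2 * pi) = \<bar>x - y\<bar>"
      by (simp add: k abs_mult)
    also have "\<dots> < 1 * (2 * pi)"
      using assms(2-) by linarith
    finally show ?thesis .
  qed
  then have "\<bar>real_of_int k\<bar> < 1"
    by (rule mult_right_less_imp_less) simp
  then have "k = 0" by linarith
  then show ?thesis using k by simp
qed

section \<open>Values and alternating signs at the roots\<close>

theorem proposition5p4:
  fixes N :: nat and \<omega> \<omega>r :: complex and a :: "int \<Rightarrow> complex" and \<theta> :: "nat \<Rightarrow> real"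
  assumes "N \<ge> 1"
    and "cmod \<omega> = 1"
    and "\<And>n. 0 \<le> n \<Longrightarrow> n \<le> int N - 1 \<Longrightarrow> cmod (a n) < 1"
    and "a (int N) = \<omega>"
    and "a (-1) = -1"
    and "persymmetric a \<omega> N"
    and "0 \<le> \<theta> 0"
    and "strict_mono_on {0..N} \<theta>"
    and "\<theta> N < 2 * pi"
    and "{z. poly (opuc a (N + 1)) z = 0} = (\<lambda>s. exp (\<i> * of_real (\<theta> s))) ` {0..N}"
    and "\<omega>r\<^sup>2 = \<omega>"
  shows "\<exists>\<epsilon>::complex. \<epsilon> \<in> {1, -1} \<and>
    (\<forall>s\<in>{0..N}. poly (opuc a N) (exp (\<i> * of_real (\<theta> s))) =
       (-1) ^ s * \<epsilon> * inverse \<omega>r * exp (\<i> * (of_nat N - 1) * of_real (\<theta> s) / 2)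
         * of_real (sqrt (opuc_norm a N)))"
proof -
  define F where "F t = \<omega>r * (cis (t / 2) * circle_opuc a N t)" for t
  define h where "h = opuc_norm a N"
  have a_less: "cmod (a (int k)) < 1" if "k < N" for k
    using that assms(3) [of "int k"] by simp
  have h: "0 < h"
    unfolding h_def by (rule opuc_norm_pos) (rule a_less)
  have wr: "\<omega>r * cnj \<omega>r = 1"
  proof -
    have "cmod \<omega>r ^ 2 = 1"
      using assms(2,11) by (metis norm_power)
    then show ?thesis by (simp flip: complex_norm_square)
  qed
  have root_iff: "poly (opuc a (N + 1)) (cis t) = 0 \<longleftrightarrow> Im (F t) = 0" for t
  proof -
    define g where "g = cis (t / 2) * circle_opuc a N t"
    have w: "\<omega> = \<omega>r * \<omega>r"
      using assms(11) by (simp add: power2_eq_square)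
    \<comment> \<open>Writing \<open>\<omega>\<close> as the square of \<open>\<omega>r\<close>
      splits the last recurrence step symmetrically, leaving a unimodular constant times the
      imaginary part of \<open>F\<close>.\<close>
    have "g - cnj \<omega> * cnj g = cnj \<omega>r * (F t - cnj (F t))"
      unfolding F_def g_def [symmetric] w complex_cnj_mult using wr by algebra
    then have "circle_opuc a (Suc N) t = cnj \<omega>r * (F t - cnj (F t))"
      by (simp add: circle_opuc_Suc assms(4) g_def del: cis_cnj)
    moreover have "cnj \<omega>r \<noteq> 0"
      using wr by auto
    ultimately have "circle_opuc a (Suc N) t = 0 \<longleftrightarrow> Im (F t) = 0"
      by (simp add: complex_diff_cnj)
    then show ?thesis
      by (simp add: circle_opuc_def)
  qed
  have F_square: "(F t)\<^sup>2 = of_real h" if "Im (F t) = 0" for t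
  proof -
    define e f where "e = cis (t / 2)" and "f = circle_opuc a N t"
    have e: "e * cnj e = 1" and z: "cis t = e * e"
      by (simp_all add: e_def cis_mult)
    have w: "\<omega> = \<omega>r * \<omega>r"
      using assms(11) by (simp add: power2_eq_square)
    have F: "F t = \<omega>r * (e * f)"
      by (simp add: F_def e_def f_def)
    have "F t = cnj (F t)"
      using that by (simp add: complex_eq_iff)
    then have "\<omega>r * (e * f) = cnj \<omega>r * (cnj e * cnj f)"
      unfolding F complex_cnj_mult .
    then have "\<omega> * cis t * f = cnj f"
      unfolding w z using e wr by algebra
    then have "\<omega> * cis t * f\<^sup>2 = of_real h"
      unfolding f_def h_def by (rule persymmetric_circle_opuc_square [OF assms(6,2)])
    then show ?thesis
      unfolding F w z by (simp add: power2_eq_square ac_simps)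
  qed
  have F_deriv: "\<exists>E. (F has_vector_derivative E) (at t) \<and> (F t \<noteq> 0 \<longrightarrow> 0 < Im (E * cnj (F t)))" for t
  proof -
    obtain D where D: "(circle_opuc a N has_vector_derivative D) (at t)"
        "0 \<le> Im (D * cnj (circle_opuc a N t))"
      using circle_opuc_phase_increasing [of N a t] a_less by blast
    define E where "E = cis (t / 2) * D + \<i> / 2 * cis (t / 2) * circle_opuc a N t"
    have "(F has_vector_derivative \<omega>r * E) (at t)"
      unfolding F_def E_def
      by (intro has_vector_derivative_mult_right has_vector_derivative_cis_half_mult D(1))
    \<comment> \<open>The extra half-angle rotation in \<open>F\<close> supplies the strictly
      positive term.\<close>
    moreover have "0 < Im (\<omega>r * E * cnj (F t))" if "F t \<noteq> 0"
    proof -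
      have "\<omega>r * E * cnj (F t) = (\<omega>r * cnj \<omega>r) * (E * cnj (cis (t / 2) * circle_opuc a N t))"
        unfolding F_def complex_cnj_mult by (simp only: ac_simps)
      then have "Im (\<omega>r * E * cnj (F t))
          = Im (D * cnj (circle_opuc a N t)) + (cmod (circle_opuc a N t))\<^sup>2 / 2"
        unfolding wr mult_1 E_def by (simp only: Im_cis_half_mult_derivative)
      moreover have "circle_opuc a N t \<noteq> 0"
        using that by (auto simp: F_def)
      ultimately show ?thesis
        using D(2) by (simp only:) (intro add_nonneg_pos, auto)
    qed
    ultimately show ?thesis by blast
  qed
  then obtain E where E: "\<And>t. (F has_vector_derivative E t) (at t)"
      "\<And>t. F t \<noteq> 0 \<Longrightarrow> 0 < Im (E t * cnj (F t))"
    by metis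
  have ImF: "((\<lambda>t. Im (F t)) has_real_derivative Im (E t)) (at t)" for t
    unfolding has_real_derivative_iff_has_vector_derivative
    by (rule bounded_linear.has_vector_derivative [OF bounded_linear_Im E(1)])
  have strict: "\<theta> i < \<theta> j" if "i < j" "j \<le> N" for i j
    using assms(8) that by (auto simp: strict_mono_on_def)
  have range: "0 \<le> \<theta> s" "\<theta> s < 2 * pi" if "s \<le> N" for s
    using that assms(7,9) strict [of 0 s] strict [of s N] by (cases "s = 0"; cases "s = N"; force)+
  have roots: "{z. poly (opuc a (N + 1)) z = 0} = (\<lambda>s. cis (\<theta> s)) ` {0..N}"
    using assms(10) by (simp add: cis_conv_exp)
  have Im0: "Im (F (\<theta> s)) = 0" if "s \<le> N" for s
  proof -
    have "cis (\<theta> s) \<in> {z. poly (opuc a (N + 1)) z = 0}"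
      unfolding roots using that by auto
    then show ?thesis
      unfolding mem_Collect_eq root_iff .
  qed
  define x where "x s = Re (F (\<theta> s))" for s
  have Fx: "F (\<theta> s) = of_real (x s)" if "s \<le> N" for s
    using Im0 [OF that] by (simp add: complex_eq_iff x_def)
  have x_square: "(x s)\<^sup>2 = h" if "s \<le> N" for s
    using F_square [OF Im0 [OF that]] Fx [OF that] by (metis of_real_eq_iff of_real_power)
  \<comment> \<open>\<open>F\<close> is real at a root, so the slope of \<open>Im F\<close> there
    has the sign of \<open>x s\<close>.\<close>
  have x_deriv: "0 < Im (E (\<theta> s)) * x s" if "s \<le> N" for s
  proof -
    have "x s \<noteq> 0"
      using x_square [OF that] h by auto
    then show ?thesis
      using E(2) [of "\<theta> s"] Fx [OF that] by simp
  qed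
  have flip: "x (Suc s) = - x s" if Suc_s: "Suc s \<le> N" for s
  proof (rule ccontr)
    assume "x (Suc s) \<noteq> - x s"
    then have same: "x (Suc s) = x s"
      using x_square [of s] x_square [of "Suc s"] Suc_s by (metis Suc_leD power2_eq_iff)
    have "0 < Im (E (\<theta> s)) * Im (E (\<theta> (Suc s)))"
      using x_deriv [of s] x_deriv [of "Suc s"] Suc_s same
      by (auto simp: zero_less_mult_iff)
    moreover have "continuous_on {\<theta> s..\<theta> (Suc s)} (\<lambda>t. Im (F t))"
      by (intro continuous_at_imp_continuous_on ballI DERIV_isCont [OF ImF])
    ultimately obtain t where t: "\<theta> s < t" "t < \<theta> (Suc s)" "Im (F t) = 0"
      using zero_between_same_direction_crossings
        [OF strict [of s "Suc s"] Im0 [of s] Im0 [of "Suc s"] _ ImF ImF] Suc_s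
      by auto
    \<comment> \<open>The extra zero yields a root of the polynomial, hence one of the listed
      angles, yet it lies strictly between two consecutive ones.\<close>
    have "cis t \<in> (\<lambda>s. cis (\<theta> s)) ` {0..N}"
      unfolding roots [symmetric] mem_Collect_eq root_iff by (rule t(3))
    then obtain r where r: "r \<le> N" "cis t = cis (\<theta> r)"
      by auto
    have "0 \<le> t" "t < 2 * pi"
      using t range(1) [of s] range(2) [of "Suc s"] Suc_s by linarith+
    then have "t = \<theta> r"
      using r range [of r] by (intro cis_eq_imp_eq) auto
    then have "\<not> r \<le> s" "\<not> Suc s \<le> r"
      using t strict [of r s] strict [of "Suc s" r] Suc_s r by (auto simp: le_less)
    then show False by simp
  qed
  have x_alt: "x s = (-1) ^ s * x 0" if "s \<le> N" for s
    using that by (induction s) (auto simp: flip)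
  define \<epsilon> where "\<epsilon> = x 0 / sqrt h"
  have "\<epsilon>\<^sup>2 = 1"
    using x_square [of 0] h by (simp add: \<epsilon>_def power_divide)
  then have \<epsilon>: "\<epsilon> \<in> {1, -1}"
    by (simp add: power2_eq_1_iff)
  have "poly (opuc a N) (cis (\<theta> s)) = (-1) ^ s * of_real \<epsilon> * inverse \<omega>r
      * cis ((real N - 1) * \<theta> s / 2) * of_real (sqrt h)" if "s \<le> N" for s
  proof -
    have "x s = (-1) ^ s * \<epsilon> * sqrt h"
      using x_alt [OF that] h by (simp add: \<epsilon>_def)
    moreover have "poly (opuc a N) (cis (\<theta> s)) = inverse \<omega>r * cis ((real N - 1) * \<theta> s / 2) * F (\<theta> s)"
    proof -
      \<comment> \<open>One half-angle is absorbed by \<open>F\<close>, which leaves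
        \<open>N - 1\<close> in the exponent.\<close>
      have half: "cis (real N * \<theta> s / 2) = cis ((real N - 1) * \<theta> s / 2) * cis (\<theta> s / 2)"
        unfolding cis_mult by (rule arg_cong [of _ _ cis]) (simp add: field_simps)
      have "\<omega>r \<noteq> 0"
        using wr by auto
      then show ?thesis
        unfolding poly_opuc_cis F_def half by simp
    qed
    ultimately show ?thesis
      by (simp add: Fx [OF that])
  qed
  then show ?thesis
    using \<epsilon> unfolding cis_conv_exp h_def by (intro exI [of _ "of_real \<epsilon>"]) (auto simp: mult.assoc)
qed

end
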